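(* Let $q=p^k$ for some prime $p$ and some integer $k>0$. Let $Q,R,S$ be integers each of the form $p^i$ for some integer $i\ge 0$ (the exponents may differ). Let $r>0$ be an integer such that $r\equiv Q+R+S\pmod{q+1}$ and $\gcd(r,q-1)=1$. Let $m\ge 3$ be an integer with $q^2\equiv 1\pmod m$, and let $v$ be a primitive $m$-th root of unity in $\mathbb{F}_{q^2}$. Put $b:=(1-v^4)/(v^3-v)\in\mathbb{F}_{q^2}$; then $b\in\{0,1,-1\}$ if and only if $m\in\{3,4,6\}$. For $j\in\{1,2\}$ let $f_j(X):=X^r B_j(X^{q-1})$, where $$B_1(X):=X^{Q+R+S}-X^Q-X^R-X^S+b,$$ $$B_2(X):=X^{Q+R}-X^{Q+S}-X^{R+S}+bX^S-1.$$ Then the following hold. (1) $f_1(X)$ permutes $\mathbb{F}_{q^2}$ if one of the following holds: (a) $q\equiv 1\pmod m$ and $(Q,R,S)\equiv\pm(1,1,1)\pmod m$ and $\gcd(Q+R+S,q+1)=1$; (b) $q\equiv -1\pmod m$ and $(Q,R,S)\equiv\pm(1,1,1)\pmod m$ and $\gcd(Q+R+S,q-1)=1$; (c) $q\equiv 1\pmod m$ and $(Q,R,S)\equiv\pm(1,1,-1)\pmod m$ and $\gcd(Q+R-S,q+1)=1$. (2) $f_2(X)$ permutes $\mathbb{F}_{q^2}$ if one of the following holds: (a) $q\equiv 1\pmod m$ and $(Q,R,S)\equiv\pm(1,1,-1)\pmod m$ and $\gcd(Q+R+S,q+1)=1$; (b) $q\equiv -1\pmod m$ and $(Q,R,S)\equiv\pm(1,1,-1)\pmod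 m$ and $\gcd(Q+R+S,q-1)=1$; (c) $q\equiv 1\pmod m$ and $(Q,R,S)\equiv\pm(1,1,1)\pmod m$ and $\gcd(Q+R-S,q+1)=1$; (d) $q\equiv 1\pmod m$ and $(Q,R,S)\equiv\pm(1,-1,1)\pmod m$ and $\gcd(Q-R-S,q+1)=1$.
   Context: A polynomial $f(X)\in\mathbb{F}_{q^2}[X]$ permutes $\mathbb{F}_{q^2}$ if the map $\alpha\mapsto f(\alpha)$ is a bijection of $\mathbb{F}_{q^2}$. For integers $\epsilon_1,\epsilon_2,\epsilon_3$, the notation $(Q,R,S)\equiv\pm(\epsilon_1,\epsilon_2,\epsilon_3)\pmod m$ means that there is a single sign $s\in\{1,-1\}$ with $Q\equiv s\epsilon_1$, $R\equiv s\epsilon_2$, $S\equiv s\epsilon_3\pmod m$. *)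

theory Defs
  imports "HOL-Computational_Algebra.Computational_Algebra" "HOL-Number_Theory.Cong" "HOL-Library.Cardinality"
begin

definition primitive_root_of_unity :: "nat \<Rightarrow> 'a::field \<Rightarrow> bool" where
  "primitive_root_of_unity m v \<longleftrightarrow> v ^ m = 1 \<and> (\<forall>j. 0 < j \<and> j < m \<longrightarrow> v ^ j \<noteq> 1)"

(* In the uses below the type 'a is the field with q^2 elements, so bijectivity is over all of 'a. *)
definition permutes_field :: "'a::field poly \<Rightarrow> bool" where
  "permutes_field f \<longleftrightarrow> bij (poly f)"

(* (Q,R,S) = +-(e1,e2,e3) (mod m), with the same sign s in all three coordinates *)
definition cong_pm :: "int \<times> int \<times> int \<Rightarrow> int \<times> int \<times> int \<Rightarrow> int \<Rightarrow> bool" where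
  "cong_pm = (\<lambda>(Q, R, S) (e1, e2, e3) m.
     \<exists>s\<in>{1, -1}. [Q = s * e1] (mod m) \<and> [R = s * e2] (mod m) \<and> [S = s * e3] (mod m))"

definition B1 :: "nat \<Rightarrow> nat \<Rightarrow> nat \<Rightarrow> 'a::field \<Rightarrow> 'a poly" where
  "B1 Q R S b = monom 1 (Q + R + S) - monom 1 Q - monom 1 R - monom 1 S + [:b:]"

definition B2 :: "nat \<Rightarrow> nat \<Rightarrow> nat \<Rightarrow> 'a::field \<Rightarrow> 'a poly" where
  "B2 Q R S b = monom 1 (Q + R) - monom 1 (Q + S) - monom 1 (R + S) + monom b S - 1"

(* X^r * B(X^(q-1)); nat subtraction is harmless since q >= 2 in all uses *)
definition f_of :: "nat \<Rightarrow> nat \<Rightarrow> 'a::field poly \<Rightarrow> 'a poly" where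
  "f_of q r B = monom 1 r * pcompose B (monom 1 (q - 1))"

end

theory Submission
  imports Defs "HOL-Number_Theory.Residues"
begin

text \<open>
  Since \<open>v\<^sup>2 \<noteq> 1\<close>, the constant \<open>b\<close> is \<open>- (v + 1/v)\<close>. Write \<open>\<mu>\<close> for the group of
  \<open>(q + 1)\<close>-st roots of unity. As \<open>r\<close> is prime to \<open>q - 1\<close>, the polynomial \<open>X\<^sup>r B(X\<^bsup>q - 1\<^esup>)\<close>
  permutes the field once \<open>B\<close> has no root in \<open>\<mu>\<close> and \<open>x \<mapsto> x\<^sup>r B(x)\<^bsup>q - 1\<^esup>\<close> is injective on \<open>\<mu>\<close>
  (\<open>permutes_field_f_of\<close>).

  On \<open>\<mu>\<close>, where \<open>x\<^sup>q = 1/x\<close>, the latter map becomes the quotient \<open>N/D\<close> of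
  \<open>N = 1 - y\<^sub>1 y\<^sub>2 - y\<^sub>1 y\<^sub>3 - y\<^sub>2 y\<^sub>3 + b y\<^sub>1 y\<^sub>2 y\<^sub>3\<close> by \<open>D = y\<^sub>1 y\<^sub>2 y\<^sub>3 - y\<^sub>1 - y\<^sub>2 - y\<^sub>3 + b\<close>. For \<open>B\<^sub>1\<close> the
  \<open>y\<^sub>i\<close> are \<open>x\<^sup>Q\<close>, \<open>x\<^sup>R\<close>, \<open>x\<^sup>S\<close>; for \<open>B\<^sub>2 = x\<^sup>S D\<close> the third one is \<open>x\<^bsup>-S\<^esup>\<close>, so both families
  are covered by exponents \<open>d\<^sub>i\<close> that are powers of \<open>p\<close> up to sign. The choice of \<open>b\<close> makes
  two members of the pencil spanned by \<open>N\<close> and \<open>D\<close> split (\<open>num_add_den\<close>): \<open>N + v D\<close> is a constant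
  times \<open>\<Prod> (y\<^sub>i + v)\<close>, and likewise with \<open>1/v\<close> for \<open>v\<close>. So a fractional linear change of the value
  \<open>N/D\<close> turns it into \<open>\<Prod> (y\<^sub>i + v) / (y\<^sub>i + 1/v)\<close>.

  The congruences modulo \<open>m\<close> say that raising \<open>v\<close> to the power \<open>d\<^sub>i\<close> gives \<open>v\<close> or \<open>1/v\<close>. Hence, by
  additivity of Frobenius, each factor is a constant times a power, with exponent \<open>\<plusminus>\<bar>d\<^sub>i\<bar>\<close>, of the
  single function \<open>h(x) = (x + v) / (x + 1/v)\<close>. If two points of \<open>\<mu>\<close> have the same value of \<open>N/D\<close>,
  then \<open>T = h(x) / h(x')\<close> satisfies \<open>T\<^sup>n = 1\<close> with \<open>n = \<Sum> \<plusminus>\<bar>d\<^sub>i\<bar>\<close>. Applying the same argument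
  to the exponent \<open>-q\<close>, which fixes \<open>\<mu>\<close> pointwise, gives \<open>T\<^bsup>q + e\<^esup> = 1\<close> when \<open>q \<equiv> e = \<plusminus>1\<close> modulo
  \<open>m\<close>. The gcd condition makes \<open>n\<close> and \<open>q + e\<close> coprime, so \<open>T = 1\<close> and \<open>x = x'\<close>
  (\<open>num_den_inj\<close>). When \<open>e = -1\<close>, \<open>h\<close> can have a zero or a pole on \<open>\<mu>\<close>; these points cause no
  trouble because then all three exponents of \<open>h\<close> have the same sign.
\<close>

section \<open>Powers in finite fields\<close>

lemma power_card_minus_one:
  fixes x :: "'a::{field,finite}"
  assumes "x \<noteq> 0"
  shows "x ^ (CARD('a) - 1) = 1"
proof -
  have "(\<Prod>y\<in>UNIV-{0}. x * y) = x ^ (CARD('a) - 1) * \<Prod>(UNIV-{0})"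
    by (simp add: prod.distrib)
  moreover have "(\<Prod>y\<in>UNIV-{0}. x * y) = \<Prod>(UNIV-{0})"
    by (rule prod.reindex_bij_witness[of _ "\<lambda>y. y / x" "\<lambda>y. x * y"]) (use assms in auto)
  ultimately show ?thesis
    by simp
qed

lemma CHAR_eq_of_CARD_prime_power:
  assumes "prime p" and "CARD('a::{field,finite}) = p ^ n"
  shows "CHAR('a) = p"
proof -
  have "prime CHAR('a)"
    by (simp add: prime_CHAR_semidom finite_imp_CHAR_pos)
  moreover have "CHAR('a) dvd p ^ n"
    using CHAR_dvd_CARD[where 'a = 'a] assms by simp
  ultimately show ?thesis
    using assms(1) prime_dvd_power primes_dvd_imp_eq by blast
qed

lemma powi_cong:
  fixes x :: "'a::field"
  assumes "x ^ m = 1" and "x \<noteq> 0" and "[a = c] (mod int m)"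
  shows "x powi a = x powi c"
proof -
  obtain k where "a = c + int m * k"
    using assms(3) by (metis cong_iff_lin cong_sym)
  then show ?thesis
    using assms by (simp add: power_int_add power_int_mult)
qed

lemma powi_eq_1_of_coprime:
  fixes x :: "'a::field"
  assumes "x \<noteq> 0" and "x powi a = 1" and "x powi c = 1" and "coprime a c"
  shows "x = 1"
proof -
  obtain u w where "u * a + w * c = 1"
    using bezout_int[of a c] assms(4) by auto
  then have "x = x powi (a * u + c * w)"
    by (simp add: mult.commute)
  also have "\<dots> = 1"
    using assms by (simp add: power_int_add power_int_mult)
  finally show ?thesis .
qed

lemma power_commute_exponents:
  fixes x :: "'a::monoid_mult"
  shows "(x ^ r) ^ n = (x ^ n) ^ r"
  by (metis mult.commute power_mult)

section \<open>Reduction to roots of unity\<close>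

text \<open>
  From \<open>f(a) = f(c)\<close> the hypothesis gives \<open>(a/c)\<^bsup>q - 1\<^esup> = 1\<close>; then the values of \<open>B\<close> cancel and leave
  \<open>(a/c)\<^sup>r = 1\<close>.
\<close>
lemma permutes_field_f_of:
  fixes B :: "'a::{field,finite} poly"
  assumes card: "CARD('a) = q\<^sup>2" and q: "q \<ge> 1" and r: "r > 0" "gcd r (q - 1) = 1"
    and nz: "\<And>x. x ^ (q + 1) = 1 \<Longrightarrow> poly B x \<noteq> 0"
    and inj: "\<And>x x'. \<lbrakk>x ^ (q + 1) = 1; x' ^ (q + 1) = 1;
      x ^ r * poly B x ^ (q - 1) = x' ^ r * poly B x' ^ (q - 1)\<rbrakk> \<Longrightarrow> x = x'"
  shows "permutes_field (f_of q r B)"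
proof -
  have val: "poly (f_of q r B) a = a ^ r * poly B (a ^ (q - 1))" for a
    by (simp add: f_of_def poly_pcompose poly_monom)
  have mu: "(a ^ (q - 1)) ^ (q + 1) = 1" if "a \<noteq> 0" for a :: 'a
  proof -
    have "(q - 1) * (q + 1) = CARD('a) - 1"
      using q by (cases q) (simp_all add: card power2_eq_square)
    then show ?thesis
      using power_card_minus_one[OF that] by (metis power_mult)
  qed
  have zero: "poly (f_of q r B) a = 0 \<longleftrightarrow> a = 0" for a
    using nz[OF mu[of a]] r by (auto simp: val)
  have "inj (poly (f_of q r B))"
  proof (rule injI)
    fix a c assume eq: "poly (f_of q r B) a = poly (f_of q r B) c"
    show "a = c"
    proof (cases "a = 0 \<or> c = 0")
      case True
      then show ?thesis using eq zero by metis
    next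
      case False
      then have a: "a \<noteq> 0" and c: "c \<noteq> 0" by auto
      have "(a ^ r * poly B (a ^ (q - 1))) ^ (q - 1) = (c ^ r * poly B (c ^ (q - 1))) ^ (q - 1)"
        using eq by (simp add: val)
      then have "(a ^ (q - 1)) ^ r * poly B (a ^ (q - 1)) ^ (q - 1)
          = (c ^ (q - 1)) ^ r * poly B (c ^ (q - 1)) ^ (q - 1)"
        by (simp add: power_mult_distrib power_commute_exponents[of _ r])
      then have same: "a ^ (q - 1) = c ^ (q - 1)"
        using inj mu a c by blast
      then have "a ^ r = c ^ r"
        using eq nz[OF mu[OF c]] by (simp add: val)
      then have "(a / c) powi int r = 1" "(a / c) powi int (q - 1) = 1"
        using same c by (simp_all only: power_int_of_nat power_divide) simp_all
      moreover have "coprime (int r) (int (q - 1))"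
        using r by (simp add: coprime_iff_gcd_eq_1)
      ultimately have "a / c = 1"
        using powi_eq_1_of_coprime a c by (metis divide_eq_0_iff)
      then show ?thesis using c by simp
    qed
  qed
  then show ?thesis
    by (simp add: permutes_field_def bij_def finite_UNIV_inj_surj)
qed

section \<open>A split pencil of cubic forms\<close>

definition num :: "'a::field \<Rightarrow> 'a \<Rightarrow> 'a \<Rightarrow> 'a \<Rightarrow> 'a" where
  "num b x y z = 1 - x * y - x * z - y * z + b * x * y * z"

definition den :: "'a::field \<Rightarrow> 'a \<Rightarrow> 'a \<Rightarrow> 'a \<Rightarrow> 'a" where
  "den b x y z = x * y * z - x - y - z + b"

text \<open>
  The value \<open>b = - (v + 1/v)\<close> is the one for which this member of the pencil splits. It is symmetric
  in \<open>v\<close> and \<open>1/v\<close>, so a second member splits too. For \<open>x = y = z\<close> and \<open>v\<^sup>2 \<noteq> 1\<close> the two identities say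
  that \<open>num/den\<close> is the cubing map up to fractional linear changes of variable and value.
\<close>
lemma num_add_den:
  fixes v :: "'a::field"
  assumes "v \<noteq> 0"
  shows "num (- (v + inverse v)) x y z + v * den (- (v + inverse v)) x y z
    = - (inverse v * ((x + v) * (y + v) * (z + v)))"
  using assms by (simp add: num_def den_def field_simps)

text \<open>
  The quotient \<open>cross v x x' / cross v x' x\<close> is the cross-ratio \<open>h(x) / h(x')\<close> for
  \<open>h(x) = (x + v) / (x + 1/v)\<close>. The undivided form remains meaningful at the zero and the pole
  of \<open>h\<close>.
\<close>
definition cross :: "'a::field \<Rightarrow> 'a \<Rightarrow> 'a \<Rightarrow> 'a" where
  "cross v x x' = (x + v) * (x' + inverse v)"

lemma cross_sym_imp_eq:
  fixes v :: "'a::field"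
  assumes "inverse v \<noteq> v" and "cross v x x' = cross v x' x"
  shows "x = x'"
proof -
  have "(x - x') * (inverse v - v) = 0"
    using assms(2) by (simp add: cross_def algebra_simps)
  then show ?thesis using assms(1) by simp
qed

text \<open>
  Equal values of \<open>num/den\<close> have equal images under the fractional linear map
  \<open>t \<mapsto> (t + v) / (t + 1/v)\<close>, and by \<open>num_add_den\<close> these images are, up to one common
  constant, products of values of \<open>h\<close>.
\<close>
lemma cross_prod_eq:
  fixes v :: "'a::field"
  assumes v: "v \<noteq> 0" and b: "b = - (v + inverse v)"
    and eq: "num b x y z * den b x' y' z' = num b x' y' z' * den b x y z"
  shows "cross v x x' * cross v y y' * cross v z z' = cross v x' x * cross v y' y * cross v z' z"
proof -
  define P D P' D' where "P = num b x y z" and "D = den b x y z"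
    and "P' = num b x' y' z'" and "D' = den b x' y' z'"
  have A: "P + v * D = - (inverse v * ((x + v) * (y + v) * (z + v)))"
      "P' + v * D' = - (inverse v * ((x' + v) * (y' + v) * (z' + v)))"
    using num_add_den[OF v] by (simp_all add: b P_def D_def P'_def D'_def)
  have C: "P + inverse v * D = - (v * ((x + inverse v) * (y + inverse v) * (z + inverse v)))"
      "P' + inverse v * D' = - (v * ((x' + inverse v) * (y' + inverse v) * (z' + inverse v)))"
    using num_add_den[of "inverse v"] v by (simp_all add: b P_def D_def P'_def D'_def add.commute)
  have "(P + v * D) * (P' + inverse v * D') - (P' + v * D') * (P + inverse v * D)
      = (v - inverse v) * (P' * D - P * D')"
    by (simp add: algebra_simps)
  then have "(P + v * D) * (P' + inverse v * D') = (P' + v * D') * (P + inverse v * D)"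
    using eq by (simp add: P_def D_def P'_def D'_def)
  then show ?thesis
    unfolding A C cross_def using v by (simp add: mult_ac)
qed

section \<open>Frobenius powers that fix or invert the root of unity\<close>

text \<open>
  The exponent \<open>d\<close> is a power of the characteristic or the negative of one; the sign \<open>a\<close> records
  whether raising to the power \<open>d\<close> fixes or inverts \<open>v\<close>.
\<close>
definition twisted_frobenius :: "'a::field \<Rightarrow> int \<Rightarrow> int \<Rightarrow> bool" where
  "twisted_frobenius v d a \<longleftrightarrow>
     (\<exists>i. \<bar>d\<bar> = int (CHAR('a) ^ i)) \<and> a \<in> {1, -1} \<and> v powi d = v powi a"

lemma twisted_frobenius_inverse:
  "twisted_frobenius v d a \<Longrightarrow> twisted_frobenius (inverse v) d a"
  by (simp add: twisted_frobenius_def power_int_inverse)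

lemma twisted_frobenius_minus:
  "twisted_frobenius v d a \<Longrightarrow> twisted_frobenius v (- d) (- a)"
  by (auto simp: twisted_frobenius_def power_int_minus)

lemma add_power_frobenius:
  fixes v x y :: "'a::{field,finite}"
  assumes "twisted_frobenius v d a"
  shows "(x + y) ^ nat \<bar>d\<bar> = x ^ nat \<bar>d\<bar> + y ^ nat \<bar>d\<bar>"
proof -
  obtain i where "nat \<bar>d\<bar> = CHAR('a) ^ i"
    using assms by (metis nat_int twisted_frobenius_def)
  moreover have "prime CHAR('a)"
    by (simp add: prime_CHAR_semidom finite_imp_CHAR_pos)
  ultimately show ?thesis
    by (simp add: freshmans_dream')
qed

lemma sgn_powi_power:
  fixes x :: "'a::field"
  shows "(x powi sgn d) ^ nat \<bar>d\<bar> = x powi d"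
  by (simp add: power_int_power' sgn_mult_abs)

text \<open>
  The exponent \<open>a * sgn d\<close> is chosen so that the second summand becomes \<open>v\<close> again after raising
  to the power \<open>\<bar>d\<bar>\<close>.
\<close>
lemma twisted_frobenius_add:
  fixes v x :: "'a::{field,finite}"
  assumes tf: "twisted_frobenius v d a"
  shows "x powi d + v = (x powi sgn d + v powi (a * sgn d)) ^ nat \<bar>d\<bar>"
proof -
  have a: "a * a = 1"
    using tf by (auto simp: twisted_frobenius_def)
  have "v powi (a * d) = (v powi d) powi a"
    by (subst mult.commute) (rule power_int_mult)
  also have "\<dots> = v powi (a * a)"
    using tf by (simp add: twisted_frobenius_def power_int_mult)
  finally have "(v powi (a * sgn d)) ^ nat \<bar>d\<bar> = v"
    by (simp add: a power_int_power' mult.assoc sgn_mult_abs)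
  then show ?thesis
    by (simp add: add_power_frobenius[OF tf] sgn_powi_power)
qed

lemma sgn_twisted_frobenius:
  fixes v :: "'a::{field,finite}"
  assumes "twisted_frobenius v d a"
  shows "d \<noteq> 0" "sgn d \<in> {1, -1}"
proof -
  have "CHAR('a) > 0" by (simp add: finite_imp_CHAR_pos)
  then show "d \<noteq> 0" using assms by (auto simp: twisted_frobenius_def)
  then show "sgn d \<in> {1, -1}" by (auto simp: sgn_if)
qed

lemma twisted_frobenius_root:
  fixes v x :: "'a::{field,finite}"
  assumes tf: "twisted_frobenius v d a" and nz: "v \<noteq> 0" "x \<noteq> 0" and root: "x powi d + v = 0"
  shows "x + v powi a = 0"
proof -
  have "x powi sgn d + v powi (a * sgn d) = 0"
    using root twisted_frobenius_add[OF tf, of x] by simp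
  then show ?thesis
    using sgn_twisted_frobenius(2)[OF tf] nz
    by (auto simp: power_int_minus eq_neg_iff_add_eq_0[symmetric] inverse_eq_iff_eq
        simp flip: inverse_minus_eq)
qed

text \<open>
  The four sign combinations reduce to \<open>1/x + 1/v = (x + v) / (x v)\<close> and
  \<open>1/x + v = v (x + 1/v) / x\<close>. The extra factor is symmetric in \<open>x\<close> and \<open>x'\<close>, so it
  disappears from the cross-ratio.
\<close>
lemma cross_twisted_frobenius:
  fixes v x x' :: "'a::{field,finite}"
  assumes tf: "twisted_frobenius v d a" and nz: "v \<noteq> 0" "x \<noteq> 0" "x' \<noteq> 0"
  shows "cross v (x powi d) (x' powi d)
    = (if d > 0 then 1 else inverse (x * x')) ^ nat \<bar>d\<bar>
      * (if a = 1 then cross v x x' else cross v x' x) ^ nat \<bar>d\<bar>"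
proof -
  have "a \<in> {1, -1}" using tf by (simp add: twisted_frobenius_def)
  then have "(x powi sgn d + v powi (a * sgn d)) * (x' powi sgn d + inverse v powi (a * sgn d))
      = (if d > 0 then 1 else inverse (x * x')) * (if a = 1 then cross v x x' else cross v x' x)"
    using sgn_twisted_frobenius[OF tf] nz
    by (auto simp: sgn_if cross_def power_int_minus field_simps split: if_splits)
  then show ?thesis
    unfolding cross_def twisted_frobenius_add[OF tf]
      twisted_frobenius_add[OF twisted_frobenius_inverse[OF tf]] power_mult_distrib[symmetric]
    by simp
qed

lemma cross_ratio_twisted_frobenius:
  fixes v x x' :: "'a::{field,finite}"
  assumes tf: "twisted_frobenius v d a" and nz: "v \<noteq> 0" "x \<noteq> 0" "x' \<noteq> 0"
  shows "cross v (x powi d) (x' powi d) / cross v (x' powi d) (x powi d)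
    = (cross v x x' / cross v x' x) powi (a * \<bar>d\<bar>)"
proof -
  have "a \<in> {1, -1}" using tf by (simp add: twisted_frobenius_def)
  moreover have "z powi \<bar>d\<bar> = z ^ nat \<bar>d\<bar>" for z :: 'a
    by (simp add: power_int_def)
  ultimately show ?thesis
    using nz unfolding cross_twisted_frobenius[OF tf nz] cross_twisted_frobenius[OF tf nz(1,3,2)]
    by (auto simp: power_int_minus power_divide mult.commute[of x'])
qed


section \<open>The quotient of cubic forms on the roots of unity\<close>

text \<open>
  The form of the hypotheses common to all cases of the theorem: \<open>e\<close> is the residue \<open>\<plusminus>1\<close> of \<open>q\<close>
  modulo \<open>m\<close>, and the integer required to be prime to \<open>q + e\<close> is the exponent of \<open>h\<close> in the product
  of the three factors. For \<open>e = -1\<close> the function \<open>h\<close> may vanish or have a pole, and the equality of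
  the signs keeps such points apart from all others.
\<close>
locale twisted_cubic =
  fixes v b :: "'a::{field,finite}" and q :: nat and e d1 a1 d2 a2 d3 a3 :: int
  assumes v: "v \<noteq> 0" "inverse v \<noteq> v" and b: "b = - (v + inverse v)"
    and tq: "twisted_frobenius v (int q) e"
    and tf: "twisted_frobenius v d1 a1" "twisted_frobenius v d2 a2" "twisted_frobenius v d3 a3"
    and signs: "e = 1 \<or> a1 = a2 \<and> a2 = a3"
    and cop: "coprime (a1 * \<bar>d1\<bar> + a2 * \<bar>d2\<bar> + a3 * \<bar>d3\<bar>) (int q + e)"
begin

abbreviation N :: "'a \<Rightarrow> 'a" where
  "N x \<equiv> num b (x powi d1) (x powi d2) (x powi d3)"

abbreviation D :: "'a \<Rightarrow> 'a" where
  "D x \<equiv> den b (x powi d1) (x powi d2) (x powi d3)"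

lemma mu_nonzero:
  assumes "x ^ (q + 1) = (1::'a)"
  shows "x \<noteq> 0"
  using assms by auto

lemma mu_power:
  assumes "x ^ (q + 1) = (1::'a)"
  shows "x ^ q = inverse x"
  using assms mu_nonzero[OF assms] by (simp add: field_simps)

lemma mu_powi:
  assumes "x ^ (q + 1) = (1::'a)"
  shows "x powi (- int q) = x"
  using mu_power[OF assms] by (simp add: power_int_minus)

lemma e_cases: "e = 1 \<or> e = -1"
  using tq by (auto simp: twisted_frobenius_def)

lemma frobenius_add: "(x + y :: 'a) ^ q = x ^ q + y ^ q"
  using add_power_frobenius[OF tq] by simp

lemma frobenius_diff: "(x - y :: 'a) ^ q = x ^ q - y ^ q"
  using frobenius_add[of "x - y" y] by (simp add: algebra_simps)

lemma b_power: "b ^ q = b"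
proof -
  have "q \<noteq> 0" using sgn_twisted_frobenius(1)[OF tq] by simp
  then have "b ^ q = - (v ^ q + inverse v ^ q)"
    using frobenius_diff[of 0 "v + inverse v"] frobenius_add[of v "inverse v"] by (simp add: b)
  moreover have "v ^ q = v powi e" "inverse v ^ q = inverse v powi e"
    using tq twisted_frobenius_inverse[OF tq] by (simp_all add: twisted_frobenius_def)
  ultimately show ?thesis
    using e_cases by (auto simp: b power_int_minus add.commute)
qed

text \<open>
  Since \<open>-q\<close> fixes the point \<open>x\<close> but inverts \<open>v\<close>, the point \<open>x = -v\<close> would also be \<open>-1/v\<close>,
  and conversely.
\<close>
lemma mu_shift_nonzero:
  assumes x: "x ^ (q + 1) = 1" and "e = 1"
  shows "x + v \<noteq> 0" "x + inverse v \<noteq> 0"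
proof -
  note tq' = twisted_frobenius_minus[OF tq]
  have "x + inverse v = 0" if "x + v = 0"
    using twisted_frobenius_root[OF tq' v(1) mu_nonzero[OF x]] that \<open>e = 1\<close>
    by (simp only: mu_powi[OF x]) (simp add: power_int_minus)
  moreover have "x + v = 0" if "x + inverse v = 0"
    using twisted_frobenius_root[OF twisted_frobenius_inverse[OF tq'] _ mu_nonzero[OF x]] that
      \<open>e = 1\<close> v(1)
    by (simp only: mu_powi[OF x]) (simp add: power_int_minus)
  ultimately show "x + v \<noteq> 0" "x + inverse v \<noteq> 0"
    using v(2) by (metis add_left_cancel)+
qed

lemma den_power:
  assumes x: "x ^ (q + 1) = 1"
  shows "D x ^ q * x powi (d1 + d2 + d3) = N x"
proof -
  have y: "(x powi d) ^ q = inverse (x powi d)" for d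
    using mu_power[OF x] by (metis power_int_inverse power_int_power power_int_power' mult.commute)
  show ?thesis
    using mu_nonzero[OF x]
    by (simp add: den_def num_def frobenius_add frobenius_diff power_mult_distrib y b_power
        power_int_add field_simps)
qed

text \<open>
  A zero of the denominator is also one of the numerator, by \<open>den_power\<close>, and hence of both split
  members of the pencil. Some factor then forces \<open>x = - v powi a\<close> and some factor
  \<open>x = - inverse v powi a'\<close>. For \<open>e = 1\<close> neither can happen, and for \<open>e = -1\<close> the signs \<open>a\<close>
  and \<open>a'\<close> agree, which contradicts \<open>inverse v \<noteq> v\<close>.
\<close>
lemma den_nonzero:
  assumes x: "x ^ (q + 1) = 1"
  shows "D x \<noteq> 0"
proof
  assume D: "D x = 0"
  have "q \<noteq> 0" using sgn_twisted_frobenius(1)[OF tq] by simp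
  then have "N x = 0"
    using den_power[OF x] D by (simp add: zero_power)
  then have "\<exists>d\<in>{d1, d2, d3}. x powi d + v = 0" "\<exists>d\<in>{d1, d2, d3}. x powi d + inverse v = 0"
    using D num_add_den[OF v(1), of "x powi d1" "x powi d2" "x powi d3"]
      num_add_den[of "inverse v" "x powi d1" "x powi d2" "x powi d3"] v(1)
    by (auto simp: b add.commute)
  then obtain a a' where a: "a \<in> {a1, a2, a3}" "x + v powi a = 0"
    and a': "a' \<in> {a1, a2, a3}" "x + inverse v powi a' = 0"
    using twisted_frobenius_root[OF _ v(1) mu_nonzero[OF x]]
      twisted_frobenius_root[OF twisted_frobenius_inverse _ mu_nonzero[OF x]] tf v(1)
    by (metis insertCI insertE nonzero_imp_inverse_nonzero singletonD)
  have pm: "a = 1 \<or> a = -1"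
    using a(1) tf by (auto simp: twisted_frobenius_def)
  show False
  proof (cases "e = 1")
    case True
    then show False
      using pm a(2) mu_shift_nonzero[OF x] by (auto simp: power_int_minus)
  next
    case False
    then have "a' = a"
      using signs a(1) a'(1) by auto
    then have "v powi a = inverse v powi a"
      using a(2) a'(2) by (metis add_left_cancel)
    then show False
      using pm v(2) by (auto simp: power_int_minus)
  qed
qed

text \<open>
  The two relations \<open>T\<^sup>n = 1\<close> and \<open>T\<^bsup>q + e\<^esup> = 1\<close> on the cross-ratio \<open>T\<close> have coprime exponents. A
  cross-ratio that is not a nonzero field element is treated on its undivided numerator \<open>U\<close>
  and denominator \<open>W\<close>.
\<close>
lemma num_den_inj:
  assumes x: "x ^ (q + 1) = 1" and x': "x' ^ (q + 1) = 1"
    and eq: "N x * D x' = N x' * D x"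
  shows "x = x'"
proof -
  define U W where "U = cross v x x'" and "W = cross v x' x"
  note nz = v(1) mu_nonzero[OF x] mu_nonzero[OF x']
  note nz' = v(1) mu_nonzero[OF x'] mu_nonzero[OF x]
  note prod = cross_prod_eq[OF v(1) b eq]
  have "U = W"
  proof (cases "U = 0 \<or> W = 0")
    case True
    then have "e \<noteq> 1"
      using mu_shift_nonzero[OF x] mu_shift_nonzero[OF x'] by (auto simp: U_def W_def cross_def)
    then have "a1 = a2" "a2 = a3"
      using signs by auto
    have zero: "cross v (x powi d) (x' powi d) = 0 \<longleftrightarrow> (if a = 1 then U else W) = 0"
        "cross v (x' powi d) (x powi d) = 0 \<longleftrightarrow> (if a = 1 then W else U) = 0"
      if "twisted_frobenius v d a" for d a
      unfolding cross_twisted_frobenius[OF that nz] cross_twisted_frobenius[OF that nz']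
      using nz sgn_twisted_frobenius(1)[OF that] by (auto simp: U_def W_def)
    \<comment> \<open>With equal signs, \<open>prod\<close> is up to nonzero factors an equation between a power of \<open>U\<close> and a
      power of \<open>W\<close>, so both vanish together.\<close>
    have "(if a1 = 1 then U else W) = 0 \<longleftrightarrow> (if a1 = 1 then W else U) = 0"
      using arg_cong[OF prod, of "\<lambda>z. z = 0"] zero[OF tf(1)] zero[OF tf(2)] zero[OF tf(3)]
      unfolding \<open>a1 = a2\<close> \<open>a2 = a3\<close> by simp
    then show ?thesis
      using True by (auto split: if_splits)
  next
    case False
    define T where "T = U / W"
    have T: "T \<noteq> 0" using False by (simp add: T_def)
    have ratio: "cross v (x powi d) (x' powi d) / cross v (x' powi d) (x powi d)
        = T powi (a * \<bar>d\<bar>)" if "twisted_frobenius v d a" for d a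
      using cross_ratio_twisted_frobenius[OF that nz] by (simp add: T_def U_def W_def)
    have nonzero: "cross v (x' powi d) (x powi d) \<noteq> 0" if "twisted_frobenius v d a" for d a
      using ratio[OF that] T by auto
    have "T powi (a1 * \<bar>d1\<bar> + a2 * \<bar>d2\<bar> + a3 * \<bar>d3\<bar>) = 1"
      using prod nonzero[OF tf(1)] nonzero[OF tf(2)] nonzero[OF tf(3)] T
      by (simp add: power_int_add flip: ratio[OF tf(1)] ratio[OF tf(2)] ratio[OF tf(3)])
    \<comment> \<open>\<open>-q\<close> is itself a twisted Frobenius exponent, of sign \<open>-e\<close>, and \<open>x powi (-q) = x\<close>.\<close>
    moreover have "T = T powi (- e * int q)"
      using ratio[OF twisted_frobenius_minus[OF tq]]
      unfolding mu_powi[OF x] mu_powi[OF x'] by (simp add: T_def U_def W_def)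
    then have "T powi (int q + e) = 1"
      using e_cases T by (auto simp: power_int_add power_int_diff power_int_minus field_simps)
    ultimately have "T = 1"
      using powi_eq_1_of_coprime[OF T] cop by blast
    then show ?thesis
      using False by (simp add: T_def)
  qed
  then show ?thesis
    using cross_sym_imp_eq v(2) by (simp add: U_def W_def)
qed

text \<open>
  The factor \<open>c\<close> absorbs the power \<open>x\<^sup>S\<close> by which \<open>B\<^sub>2\<close> differs from \<open>D\<close>; the condition \<open>c_power\<close> says
  that it cancels from \<open>x\<^sup>r B(x)\<^bsup>q - 1\<^esup>\<close>.
\<close>
lemma permutes:
  fixes B :: "'a poly"
  assumes card: "CARD('a) = q\<^sup>2" and r: "r > 0" "gcd r (q - 1) = 1"
    and B: "\<And>x. x ^ (q + 1) = 1 \<Longrightarrow> poly B x = c x * D x"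
    and c: "\<And>x. x ^ (q + 1) = 1 \<Longrightarrow> c x \<noteq> 0"
    and c_power: "\<And>x. x ^ (q + 1) = 1 \<Longrightarrow> x ^ r * c x ^ q = c x * x powi (d1 + d2 + d3)"
  shows "permutes_field (f_of q r B)"
proof (rule permutes_field_f_of[OF card _ r])
  show "q \<ge> 1" using sgn_twisted_frobenius(1)[OF tq] by simp
  then have Suc: "q = Suc (q - 1)" by simp
  show "poly B x \<noteq> 0" if "x ^ (q + 1) = 1" for x
    using B c den_nonzero that by simp
  have quotient: "x ^ r * poly B x ^ (q - 1) = N x / D x" if x: "x ^ (q + 1) = 1" for x
  proof -
    have "x ^ r * poly B x ^ (q - 1) * poly B x = x ^ r * poly B x ^ q"
      by (subst (2) Suc) simp
    also have "\<dots> = c x * (D x ^ q * x powi (d1 + d2 + d3))"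
      using c_power[OF x] by (simp add: B[OF x] power_mult_distrib mult_ac)
    also have "\<dots> = c x * N x"
      by (simp only: den_power[OF x])
    finally show ?thesis
      using c[OF x] den_nonzero[OF x] by (simp add: B[OF x] eq_divide_eq mult_ac)
  qed
  fix x x'
  assume x: "x ^ (q + 1) = 1" and x': "x' ^ (q + 1) = 1"
    and "x ^ r * poly B x ^ (q - 1) = x' ^ r * poly B x' ^ (q - 1)"
  then have "N x / D x = N x' / D x'"
    by (simp only: quotient)
  then show "x = x'"
    using num_den_inj[OF x x'] den_nonzero[OF x] den_nonzero[OF x'] by (simp add: frac_eq_eq)
qed

end

section \<open>The two families of polynomials\<close>

lemma permutes_B1:
  fixes v b :: "'a::{field,finite}"
  assumes "twisted_cubic v b q e (int Q) a1 (int R) a2 (int S) a3"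
    and card: "CARD('a) = q\<^sup>2" and r: "r > 0" "gcd r (q - 1) = 1"
    and cong: "[r = Q + R + S] (mod (q + 1))"
  shows "permutes_field (f_of q r (B1 Q R S b))"
proof -
  interpret twisted_cubic v b q e "int Q" a1 "int R" a2 "int S" a3 by fact
  show ?thesis
  proof (rule permutes[OF card r, where c = "\<lambda>_. 1"])
    fix x :: 'a assume x: "x ^ (q + 1) = 1"
    show "poly (B1 Q R S b) x = 1 * D x"
      by (simp add: B1_def den_def poly_monom power_add)
    have "x powi int r = x powi (int Q + int R + int S)"
      by (rule powi_cong[OF x mu_nonzero[OF x]]) (use cong in \<open>simp flip: cong_int_iff\<close>)
    then show "x ^ r * 1 ^ q = 1 * x powi (int Q + int R + int S)"
      by simp
  qed simp
qed

lemma permutes_B2: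
  fixes v b :: "'a::{field,finite}"
  assumes "twisted_cubic v b q e (int Q) a1 (int R) a2 (- int S) a3"
    and card: "CARD('a) = q\<^sup>2" and r: "r > 0" "gcd r (q - 1) = 1"
    and cong: "[r = Q + R + S] (mod (q + 1))"
  shows "permutes_field (f_of q r (B2 Q R S b))"
proof -
  interpret twisted_cubic v b q e "int Q" a1 "int R" a2 "- int S" a3 by fact
  show ?thesis
  proof (rule permutes[OF card r, where c = "\<lambda>x. x ^ S"])
    fix x :: 'a assume x: "x ^ (q + 1) = 1"
    note nz = mu_nonzero[OF x]
    show "x ^ S \<noteq> 0" using nz by simp
    show "poly (B2 Q R S b) x = x ^ S * D x"
      using nz by (simp add: B2_def den_def poly_monom power_add power_int_minus field_simps)
    have "x powi int r = x powi (int Q + int R + int S)"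
      by (rule powi_cong[OF x nz]) (use cong in \<open>simp flip: cong_int_iff\<close>)
    moreover have "(x ^ S) ^ q = inverse (x ^ S)"
      by (simp add: power_commute_exponents[of x S q] mu_power[OF x] power_inverse)
    ultimately show "x ^ r * (x ^ S) ^ q = x ^ S * x powi (int Q + int R + - int S)"
      using nz by (simp add: power_int_add power_int_diff field_simps)
  qed
qed

section \<open>The exceptional values of the constant\<close>

lemma primitive_root_of_unity_power_eq_1_iff:
  assumes "primitive_root_of_unity m v" and "m > 0"
  shows "v ^ n = 1 \<longleftrightarrow> m dvd n"
proof
  assume "v ^ n = 1"
  moreover have "v ^ n = (v ^ m) ^ (n div m) * v ^ (n mod m)"
    by (simp flip: power_mult power_add)
  ultimately have "v ^ (n mod m) = 1"
    using assms(1) by (simp add: primitive_root_of_unity_def)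
  then have "n mod m = 0"
    using assms unfolding primitive_root_of_unity_def by (metis gr0I mod_less_divisor)
  then show "m dvd n" by auto
next
  assume "m dvd n"
  then show "v ^ n = 1"
    using assms(1) by (auto simp: primitive_root_of_unity_def power_mult)
qed

text \<open>
  The three values are attained at the roots of \<open>X\<^sup>2 + 1\<close>, \<open>X\<^sup>2 + X + 1\<close> and \<open>X\<^sup>2 - X + 1\<close>. Together
  with factors that do not vanish at \<open>v\<close>, these polynomials make up \<open>X\<^sup>4 - 1\<close> and \<open>X\<^sup>6 - 1\<close>.
\<close>
lemma neg_add_inverse_special_iff:
  fixes v :: "'a::field"
  assumes v: "primitive_root_of_unity m v" and m: "m \<ge> 3"
  shows "- (v + inverse v) \<in> {0, 1, -1} \<longleftrightarrow> m \<in> {3, 4, 6}"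
proof -
  note pow = primitive_root_of_unity_power_eq_1_iff[OF v]
  have nz: "v \<noteq> 0"
    using v m by (auto simp: primitive_root_of_unity_def power_0_left)
  have sq: "v ^ 2 - 1 \<noteq> 0"
    using pow[of 2] m by (auto dest: dvd_imp_le)
  moreover have "v ^ 2 - 1 = (v - 1) * (v + 1)"
    by (simp add: power2_eq_square algebra_simps)
  ultimately have nz2: "v - 1 \<noteq> 0" "v + 1 \<noteq> 0"
    by auto
  have "- (v + inverse v) = c \<longleftrightarrow> v ^ 2 + c * v + 1 = 0" for c
  proof -
    have "- v * (- (v + inverse v) - c) = v ^ 2 + c * v + 1"
      using nz by (simp add: field_simps power2_eq_square)
    then show ?thesis
      using nz by (metis eq_iff_diff_eq_0 mult_eq_0_iff neg_equal_0_iff_equal)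
  qed
  from this[of 0] this[of 1] this[of "-1"]
  have "- (v + inverse v) = 0 \<longleftrightarrow> v ^ 2 + 1 = 0"
      "- (v + inverse v) = 1 \<longleftrightarrow> v ^ 2 + v + 1 = 0"
      "- (v + inverse v) = -1 \<longleftrightarrow> v ^ 2 - v + 1 = 0"
    by simp_all
  moreover have "v ^ 4 - 1 = (v ^ 2 - 1) * (v ^ 2 + 1)"
      "v ^ 6 - 1 = (v - 1) * (v ^ 2 + v + 1) * (v + 1) * (v ^ 2 - v + 1)"
    by (simp_all add: algebra_simps eval_nat_numeral)
  ultimately have "- (v + inverse v) \<in> {0, 1, -1} \<longleftrightarrow> v ^ 4 = 1 \<or> v ^ 6 = 1"
    using sq nz2 by auto
  also have "\<dots> \<longleftrightarrow> m dvd 4 \<or> m dvd 6"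
    using pow m by simp
  also have "\<dots> \<longleftrightarrow> m \<in> {3, 4, 6}"
  proof
    assume *: "m dvd 4 \<or> m dvd 6"
    then have "m \<le> 6" by (auto dest: dvd_imp_le)
    then have "m \<in> {3, 4, 5, 6}" using m by auto
    then show "m \<in> {3, 4, 6}" using * by auto
  qed auto
  finally show ?thesis .
qed

section \<open>The permutation polynomials\<close>

lemma twisted_frobenius_of_cong:
  fixes v :: "'a::field"
  assumes "v ^ m = 1" and "v \<noteq> 0" and "\<bar>d\<bar> = int (CHAR('a) ^ i)"
    and "a \<in> {1, -1}" and "[d = a] (mod int m)"
  shows "twisted_frobenius v d a"
  using assms powi_cong unfolding twisted_frobenius_def by blast

theorem theorem1p1:
  fixes p k q Q R S r m :: nat and v b :: "'a::{field,finite}"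
  assumes "prime p" and "k > 0" and "q = p ^ k"
    and "CARD('a) = q\<^sup>2"
    and "\<exists>i. Q = p ^ i" and "\<exists>i. R = p ^ i" and "\<exists>i. S = p ^ i"
    and "r > 0" and "[r = Q + R + S] (mod (q + 1))" and "gcd r (q - 1) = 1"
    and "m \<ge> 3" and "[q\<^sup>2 = 1] (mod m)"
    and "primitive_root_of_unity m v"
    and "b = (1 - v ^ 4) / (v ^ 3 - v)"
  shows "(b \<in> {0, 1, -1} \<longleftrightarrow> m \<in> {3, 4, 6})
    \<and> ( ([int q = 1] (mod int m) \<and> cong_pm (int Q, int R, int S) (1, 1, 1) (int m)
            \<and> gcd (int Q + int R + int S) (int q + 1) = 1)
        \<or> ([int q = -1] (mod int m) \<and> cong_pm (int Q, int R, int S) (1, 1, 1) (int m)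
            \<and> gcd (int Q + int R + int S) (int q - 1) = 1)
        \<or> ([int q = 1] (mod int m) \<and> cong_pm (int Q, int R, int S) (1, 1, -1) (int m)
            \<and> gcd (int Q + int R - int S) (int q + 1) = 1)
        \<longrightarrow> permutes_field (f_of q r (B1 Q R S b)))
    \<and> ( ([int q = 1] (mod int m) \<and> cong_pm (int Q, int R, int S) (1, 1, -1) (int m)
            \<and> gcd (int Q + int R + int S) (int q + 1) = 1)
        \<or> ([int q = -1] (mod int m) \<and> cong_pm (int Q, int R, int S) (1, 1, -1) (int m)
            \<and> gcd (int Q + int R + int S) (int q - 1) = 1)
        \<or> ([int q = 1] (mod int m) \<and> cong_pm (int Q, int R, int S) (1, 1, 1) (int m)
            \<and> gcd (int Q + int R - int S) (int q + 1) = 1)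
        \<or> ([int q = 1] (mod int m) \<and> cong_pm (int Q, int R, int S) (1, -1, 1) (int m)
            \<and> gcd (int Q - int R - int S) (int q + 1) = 1)
        \<longrightarrow> permutes_field (f_of q r (B2 Q R S b)))"
proof -
  have p: "CHAR('a) = p"
    by (rule CHAR_eq_of_CARD_prime_power[where n = "k * 2"])
      (use assms(1,3,4) in \<open>simp_all add: power_mult\<close>)
  have vm: "v ^ m = 1"
    using assms(13) by (simp add: primitive_root_of_unity_def)
  have v0: "v \<noteq> 0"
    using vm assms(11) by (auto simp: power_0_left)
  have sq: "v ^ 2 \<noteq> 1"
    using primitive_root_of_unity_power_eq_1_iff[OF assms(13), of 2] assms(11)
    by (auto dest: dvd_imp_le)
  have inv: "inverse v \<noteq> v"
    using sq v0 by (auto simp: power2_eq_square field_simps)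
  have b: "b = - (v + inverse v)"
  proof -
    have "v ^ 3 - v = v * (v ^ 2 - 1)" "1 - v ^ 4 = - (v ^ 2 + 1) * (v ^ 2 - 1)"
      by (simp_all add: algebra_simps eval_nat_numeral)
    then have "b = - (v ^ 2 + 1) / v"
      using sq assms(14) by (simp only: mult_divide_mult_cancel_right) simp
    then show ?thesis
      using v0 by (simp add: field_simps power2_eq_square)
  qed
  obtain i j l where powers: "Q = p ^ i" "R = p ^ j" "S = p ^ l"
    using assms(5-7) by blast
  have cubic: "twisted_cubic v b q e (int Q) a1 (int R) a2 (t * int S) a3"
    if "e \<in> {1, -1}" "a1 \<in> {1, -1}" "a2 \<in> {1, -1}" "a3 \<in> {1, -1}" "t \<in> {1, -1}"
      and "[int q = e] (mod int m)" "[int Q = a1] (mod int m)" "[int R = a2] (mod int m)"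
        "[int S = t * a3] (mod int m)"
      and "e = 1 \<or> a1 = a2 \<and> a2 = a3"
      and "coprime (a1 * int Q + a2 * int R + a3 * int S) (int q + e)" for e a1 a2 a3 t :: int
  proof
    have "[t * int S = t * (t * a3)] (mod int m)"
      using that(9) by (rule cong_scalar_left)
    then have "[t * int S = a3] (mod int m)"
      using that(5) by auto
    then show "twisted_frobenius v (t * int S) a3"
      using that(4,5) by (intro twisted_frobenius_of_cong[OF vm v0, of _ l]) (auto simp: p powers)
    show "twisted_frobenius v (int q) e"
      using that by (intro twisted_frobenius_of_cong[OF vm v0, of _ k]) (auto simp: p assms(3))
    show "twisted_frobenius v (int Q) a1"
      using that by (intro twisted_frobenius_of_cong[OF vm v0, of _ i]) (auto simp: p powers)
    show "twisted_frobenius v (int R) a2"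
      using that by (intro twisted_frobenius_of_cong[OF vm v0, of _ j]) (auto simp: p powers)
    have "\<bar>t * int S\<bar> = int S" using that(5) by auto
    then show "coprime (a1 * \<bar>int Q\<bar> + a2 * \<bar>int R\<bar> + a3 * \<bar>t * int S\<bar>) (int q + e)"
      using that(11) by simp
  qed (use v0 inv b that in auto)
  have scaled: "coprime (s * A) C" if "gcd A C = 1" "s \<in> {1, -1}" for s A C :: int
    using that by (auto simp: coprime_iff_gcd_eq_1)
  \<comment> \<open>In both families the common sign \<open>s\<close> of \<open>cong_pm\<close> multiplies every \<open>a\<^sub>i\<close>, hence only changes the
    sign of the integer in the gcd condition.\<close>
  have first: "permutes_field (f_of q r (B1 Q R S b))"
    if hyp: "[int q = e] (mod int m)" "e \<in> {1, -1}" "c \<in> {1, -1}" "e = 1 \<or> c = 1"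
      "cong_pm (int Q, int R, int S) (1, 1, c) (int m)"
      "gcd (int Q + int R + c * int S) (int q + e) = 1" for e c
  proof -
    obtain s where s: "s \<in> {1, -1}" "[int Q = s] (mod int m)" "[int R = s] (mod int m)"
      "[int S = s * c] (mod int m)"
      using hyp(5) unfolding cong_pm_def prod.case mult_1_right by blast
    have "twisted_cubic v b q e (int Q) s (int R) s (1 * int S) (s * c)"
      by (rule cubic) (use hyp s scaled[OF hyp(6) s(1)] in \<open>auto simp: algebra_simps\<close>)
    then show ?thesis
      using permutes_B1[OF _ assms(4,8,10,9)] by simp
  qed
  \<comment> \<open>The third exponent is \<open>-S\<close>, so \<open>S \<equiv> - s c'\<close> corresponds to the sign \<open>s c'\<close>.\<close>
  have second: "permutes_field (f_of q r (B2 Q R S b))"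
    if hyp: "[int q = e] (mod int m)" "e \<in> {1, -1}" "c \<in> {1, -1}" "c' \<in> {1, -1}"
      "e = 1 \<or> c = 1 \<and> c' = 1"
      "cong_pm (int Q, int R, int S) (1, c, - c') (int m)"
      "gcd (int Q + c * int R + c' * int S) (int q + e) = 1" for e c c'
  proof -
    obtain s where s: "s \<in> {1, -1}" "[int Q = s] (mod int m)" "[int R = s * c] (mod int m)"
      "[int S = s * - c'] (mod int m)"
      using hyp(6) unfolding cong_pm_def prod.case mult_1_right by blast
    have "twisted_cubic v b q e (int Q) s (int R) (s * c) (- 1 * int S) (s * c')"
      by (rule cubic) (use hyp s scaled[OF hyp(7) s(1)] in \<open>auto simp: algebra_simps\<close>)
    then show ?thesis
      using permutes_B2[OF _ assms(4,8,10,9)] by simp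
  qed
  show ?thesis
    using neg_add_inverse_special_iff[OF assms(13,11)] first[of 1 1] first[of "-1" 1]
      first[of 1 "-1"] second[of 1 1 1] second[of "-1" 1 1] second[of 1 1 "-1"]
      second[of 1 "-1" "-1"]
    unfolding b[symmetric] by auto
qed

end
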